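(* Let $S$ be a subtractive unique factorisation semidomain and let $I$ be a proper ideal of $S$. (1) $I$ is $k$-strongly irreducible if and only if, for all $x,y\in S$, $\operatorname{lcm}(x,y)\in I$ implies $x\in I$ or $y\in I$. (2) If $I$ is $k$-strongly irreducible, then $I$ is $k$-primary.
   Context: A semiring is a commutative semiring $(S,+,0,\cdot,1)$ with multiplicative identity $1$ and additive identity $0$ that is absorbing. An ideal is a nonempty subset closed under addition and under multiplication by elements of $S$. A $k$-ideal is an ideal $I$ such that $x+y\in I$ and $y\in I$ imply $x\in I$. $S$ is subtractive if every ideal of $S$ is a $k$-ideal. $S$ is a semidomain if $ab=ac$ with $a\ne0$ implies $b=c$. A non-zero non-unit $r$ is irreducible if $r=r_1r_2$ implies $r_1$ or $r_2$ is a unit; $p$ is prime if the principal ideal $\langle p\rangle$ is prime. A semidomain is a unique factorisation semidomain if every irreducible element is prime and every non-zero non-unit can be written uniquely (up to order and units) as a product of irreducible elements. $\operatorname{lcm}(x,y)$ is a least common multiple (with respect to divisibility), unique up to units, with $\operatorname{lcm}(x,0)=0$. A $k$-ideal $I$ is $k$-strongly irreducible if for all $k$-ideals $A,B$, $A\cap B\subseteq I$ implies $A\subseteq I$ or $B\subseteq I$; it is $k$-primary if $ab\in I$ and $a\notin I$ imply $b^n\in I$ for some natural number $n\ge1$. *)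

theory Defs
  imports Main "HOL-Library.Multiset" "HOL-Computational_Algebra.Factorial_Ring"
begin

text \<open>
  The semiring is the whole type, of class \<^class>\<open>comm_semiring_1\<close>. That class also requires
  \<open>0 \<noteq> 1\<close>, which any semiring with a proper ideal satisfies. Units are the divisors of \<open>1\<close>, and
  \<^const>\<open>irreducible\<close> is the library's constant: a non-zero non-unit all of whose
  factorisations into two factors contain a unit.
\<close>

context comm_semiring_1
begin

definition semiring_ideal :: "'a set \<Rightarrow> bool" where
  "semiring_ideal I \<longleftrightarrow>
     I \<noteq> {} \<and> (\<forall>x\<in>I. \<forall>y\<in>I. x + y \<in> I) \<and> (\<forall>s. \<forall>x\<in>I. s * x \<in> I)"

definition k_ideal :: "'a set \<Rightarrow> bool" where
  "k_ideal I \<longleftrightarrow> semiring_ideal I \<and> (\<forall>x y. x + y \<in> I \<and> y \<in> I \<longrightarrow> x \<in> I)"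

definition prime_ideal :: "'a set \<Rightarrow> bool" where
  "prime_ideal P \<longleftrightarrow>
     semiring_ideal P \<and> P \<noteq> UNIV \<and> (\<forall>a b. a * b \<in> P \<longrightarrow> a \<in> P \<or> b \<in> P)"

definition principal_ideal :: "'a \<Rightarrow> 'a set" where
  "principal_ideal p = {s * p | s. True}"

text \<open>
  Unlike \<^const>\<open>prime_elem\<close>, this does not exclude \<open>p = 0\<close>.
\<close>
definition prime_element :: "'a \<Rightarrow> bool" where
  "prime_element p \<longleftrightarrow> prime_ideal (principal_ideal p)"

definition unit_multiple :: "'a \<Rightarrow> 'a \<Rightarrow> bool" where
  "unit_multiple a b \<longleftrightarrow> (\<exists>u. u dvd 1 \<and> b = u * a)"

text \<open>
  A relation rather than a function, since least common multiples are determined only up to units.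
  As \<open>0\<close> divides only \<open>0\<close>, the only least common multiple of \<open>x\<close> and \<open>0\<close> is \<open>0\<close>.
\<close>
definition is_lcm :: "'a \<Rightarrow> 'a \<Rightarrow> 'a \<Rightarrow> bool" where
  "is_lcm m x y \<longleftrightarrow> x dvd m \<and> y dvd m \<and> (\<forall>c. x dvd c \<and> y dvd c \<longrightarrow> m dvd c)"

definition k_strongly_irreducible :: "'a set \<Rightarrow> bool" where
  "k_strongly_irreducible I \<longleftrightarrow>
     k_ideal I \<and> (\<forall>A B. k_ideal A \<and> k_ideal B \<and> A \<inter> B \<subseteq> I \<longrightarrow> A \<subseteq> I \<or> B \<subseteq> I)"

definition k_primary :: "'a set \<Rightarrow> bool" where
  "k_primary I \<longleftrightarrow>
     k_ideal I \<and> (\<forall>a b. a * b \<in> I \<and> a \<notin> I \<longrightarrow> (\<exists>n\<ge>1. b ^ n \<in> I))"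

end

class subtractive_semiring = comm_semiring_1 +
  assumes ideal_imp_k_ideal: "semiring_ideal I \<Longrightarrow> k_ideal I"

text \<open>
  The library's \<^class>\<open>semidom\<close> is not used because it also demands additive cancellation.
\<close>
class semidomain = comm_semiring_1 +
  assumes semidomain_cancel: "a \<noteq> 0 \<Longrightarrow> a * b = a * c \<Longrightarrow> b = c"

text \<open>
  A product of irreducibles, up to order, is a multiset; \<^const>\<open>rel_mset\<close> matches the factors of
  two such products bijectively, each factor with a unit multiple of itself.
\<close>
class unique_factorisation_semidomain = semidomain +
  assumes irreducible_imp_prime_element: "irreducible p \<Longrightarrow> prime_element p"
    and irreducible_factorisation_exists:
      "x \<noteq> 0 \<Longrightarrow> \<not> x dvd 1 \<Longrightarrow> \<exists>A. (\<forall>p\<in>#A. irreducible p) \<and> prod_mset A = x"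
    and irreducible_factorisation_unique:
      "x \<noteq> 0 \<Longrightarrow> \<not> x dvd 1 \<Longrightarrow>
       (\<forall>p\<in>#A. irreducible p) \<Longrightarrow> prod_mset A = x \<Longrightarrow>
       (\<forall>p\<in>#B. irreducible p) \<Longrightarrow> prod_mset B = x \<Longrightarrow>
       rel_mset unit_multiple A B"

end

theory Submission imports Defs begin

text \<open>
  In a subtractive semiring principal ideals are \<open>k\<close>-ideals, and \<open>principal_ideal x \<inter>
  principal_ideal y\<close> is generated by any least common multiple of \<open>x\<close> and \<open>y\<close>; this and the
  existence of least common multiples give the first part. For the second, let \<open>a * b \<in> I\<close> and
  split \<open>a = c * d\<close>, where \<open>c\<close> collects the prime factors dividing \<open>b\<close> and \<open>d\<close> the others.
  Then \<open>a * b = (c * b) * d\<close> is a least common multiple of \<open>c * b\<close> and \<open>d\<close>, so one of the two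
  lies in \<open>I\<close>; the first divides a power of \<open>b\<close>, and the second divides \<open>a\<close>.
\<close>

context comm_semiring_1
begin

lemma semiring_ideal_dvd:
  assumes "semiring_ideal I" "x \<in> I" "x dvd y"
  shows "y \<in> I"
  using assms unfolding semiring_ideal_def by (metis dvd_def mult.commute)

lemma zero_in_semiring_ideal: "semiring_ideal I \<Longrightarrow> 0 \<in> I"
  by (metis semiring_ideal_dvd dvd_0_right ex_in_conv semiring_ideal_def)

lemma mem_principal_ideal_iff: "y \<in> principal_ideal x \<longleftrightarrow> x dvd y"
  unfolding principal_ideal_def by (auto simp: dvd_def mult.commute)

lemma semiring_ideal_principal_ideal: "semiring_ideal (principal_ideal x)"
  unfolding semiring_ideal_def mem_principal_ideal_iff
  using mem_principal_ideal_iff by (auto intro: dvd_refl)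

lemma is_lcm_unit: "u dvd 1 \<Longrightarrow> is_lcm y u y"
  unfolding is_lcm_def by (blast intro: dvd_refl dvd_trans one_dvd)

text \<open>Cancelling \<open>p\<close> from a common multiple of \<open>p * x\<close> and
  \<open>p * y\<close> leaves a common multiple of \<open>x\<close> and \<open>y\<close>, which
  \<open>m\<close> divides.\<close>

lemma is_lcm_mult_common:
  assumes lcm: "is_lcm m x y" and cancel: "\<And>b c. p * b = p * c \<Longrightarrow> b = c"
  shows "is_lcm (p * m) (p * x) (p * y)"
  unfolding is_lcm_def
proof (intro conjI allI impI)
  show "p * x dvd p * m" "p * y dvd p * m"
    using lcm by (simp_all add: is_lcm_def mult_dvd_mono)
next
  fix c assume c: "p * x dvd c \<and> p * y dvd c"
  then obtain s t where s: "c = p * (x * s)" and t: "c = p * (y * t)"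
    by (metis dvd_def mult.assoc)
  from s t have "x * s = y * t" by (metis cancel)
  then have "m dvd x * s"
    using lcm unfolding is_lcm_def by (metis dvd_triv_left)
  then show "p * m dvd c" by (simp add: s mult_dvd_mono)
qed

end

context unique_factorisation_semidomain
begin

lemma irreducible_dvd_mult:
  assumes "irreducible p" "p dvd a * b"
  shows "p dvd a \<or> p dvd b"
  using irreducible_imp_prime_element[OF assms(1)] assms(2)
  unfolding prime_element_def prime_ideal_def mem_principal_ideal_iff by blast

lemma irreducible_cancel:
  "irreducible p \<Longrightarrow> p * b = p * c \<Longrightarrow> b = c"
  using semidomain_cancel irreducible_def by blast

lemma irreducible_mult_dvd_cancel:
  assumes "irreducible p" "p * x dvd p * y"
  shows "x dvd y"
  using assms by (metis dvd_def irreducible_cancel mult.assoc)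

text \<open>Existence of factorisations recast as an induction rule, so that later arguments add one
  irreducible factor at a time instead of handling multisets.\<close>

lemma irreducible_induct [consumes 1, case_names unit mult]:
  assumes "x \<noteq> 0"
    and unit: "\<And>u. u dvd 1 \<Longrightarrow> P u"
    and mult: "\<And>p x. irreducible p \<Longrightarrow> P x \<Longrightarrow> P (p * x)"
  shows "P x"
proof (cases "x dvd 1")
  case False
  then obtain A where A: "\<forall>p\<in>#A. irreducible p" "prod_mset A = x"
    using irreducible_factorisation_exists assms(1) by blast
  from A(1) have "P (prod_mset A)"
    by (induction A) (auto intro: unit mult)
  then show ?thesis using A(2) by simp
qed (rule unit)

lemma dvd_irreducible_multD:
  assumes "irreducible p" "\<not> p dvd y" "y dvd p * c"
  shows "y dvd c"
proof -
  from assms(3) obtain z where z: "p * c = y * z" by (auto simp: dvd_def)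
  then have "p dvd z"
    using irreducible_dvd_mult[OF assms(1)] assms(2) by (metis dvd_triv_left)
  then obtain w where "z = p * w" by (auto simp: dvd_def)
  with z have "p * c = p * (y * w)" by (simp add: ac_simps)
  then have "c = y * w" using irreducible_cancel assms(1) by blast
  then show ?thesis by simp
qed

text \<open>Since \<open>p\<close> is prime and does not divide \<open>y\<close>, removing
  \<open>p\<close> from a multiple of \<open>y\<close> keeps it a multiple of
  \<open>y\<close>.\<close>

lemma is_lcm_irreducible_mult:
  assumes p: "irreducible p" and lcm: "is_lcm m x y" and "\<not> p dvd y"
  shows "is_lcm (p * m) (p * x) y"
  unfolding is_lcm_def
proof (intro conjI allI impI)
  show "p * x dvd p * m" "y dvd p * m"
    using lcm by (simp_all add: is_lcm_def mult_dvd_mono dvd_mult)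
next
  fix c assume c: "p * x dvd c \<and> y dvd c"
  then obtain s where s: "c = p * (x * s)" by (auto simp: dvd_def mult.assoc)
  have "y dvd x * s" using dvd_irreducible_multD[OF p assms(3)] c s by blast
  then have "m dvd x * s" using lcm unfolding is_lcm_def by (metis dvd_triv_left)
  then show "p * m dvd c" by (simp add: s mult_dvd_mono)
qed

lemma is_lcm_exists:
  assumes "x \<noteq> 0"
  shows "\<exists>m. is_lcm m x y"
  using assms
\<comment> \<open>\<open>y\<close> has to vary: a factor \<open>p\<close> shared with
  \<open>y\<close> is removed from both arguments before the induction hypothesis applies.\<close>
proof (induction x arbitrary: y rule: irreducible_induct)
  case (unit u)
  then show ?case using is_lcm_unit by blast
next
  case (mult p x)
  show ?case
  proof (cases "p dvd y")
    case True
    then obtain z where "y = p * z" by (auto simp: dvd_def)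
    then show ?thesis
      using mult.IH[of z] is_lcm_mult_common irreducible_cancel[OF mult.hyps] by blast
  next
    case False
    then show ?thesis
      using mult.IH[of y] is_lcm_irreducible_mult[OF mult.hyps] by blast
  qed
qed

text \<open>Coprimality of \<open>d\<close> and \<open>b\<close> is expressed as the right to cancel
  \<open>b\<close> when testing divisibility by \<open>d\<close>. In the construction,
  \<open>n\<close> counts the irreducible factors put into \<open>c\<close>.\<close>

lemma coprime_part_exists:
  assumes "a \<noteq> 0"
  shows "\<exists>c d n. a = c * d \<and> c dvd b ^ n \<and> (\<forall>k. d dvd b * k \<longrightarrow> d dvd k)"
  using assms
proof (induction a rule: irreducible_induct)
  case (unit u)
  \<comment> \<open>A unit goes into \<open>d\<close>, because it divides everything.\<close>
  then have "u = 1 * u \<and> 1 dvd b ^ 0 \<and> (\<forall>k. u dvd b * k \<longrightarrow> u dvd k)"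
    by (auto intro: dvd_trans)
  then show ?case by blast
next
  case (mult p a)
  then obtain c d n where a: "a = c * d" and c: "c dvd b ^ n"
    and d: "\<And>k. d dvd b * k \<Longrightarrow> d dvd k" by blast
  show ?case
  proof (cases "p dvd b")
    case True
    then have "p * c dvd b ^ Suc n" using c by (simp add: mult_dvd_mono)
    moreover have "p * a = (p * c) * d" by (simp add: a mult.assoc)
    ultimately show ?thesis using d by blast
  next
    case False
    have "p * d dvd k" if "p * d dvd b * k" for k
    proof -
      have "p dvd b * k" using that by (rule dvd_mult_left)
      then obtain j where j: "k = p * j"
        using irreducible_dvd_mult[OF mult.hyps] False by (auto simp: dvd_def)
      have "p * d dvd p * (b * j)" using that j by (simp add: mult.left_commute)
      then have "d dvd j" using irreducible_mult_dvd_cancel mult.hyps d by blast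
      then show ?thesis by (simp add: j mult_dvd_mono)
    qed
    moreover have "p * a = c * (p * d)" by (simp add: a mult.left_commute)
    ultimately show ?thesis using c by blast
  qed
qed

end

lemma coprime_power_dvdD:
  fixes b d :: "'a::comm_semiring_1"
  assumes "\<And>k. d dvd b * k \<Longrightarrow> d dvd k" "d dvd b ^ n * k"
  shows "d dvd k"
  using assms(2) by (induction n) (auto simp: mult.assoc dest: assms(1))

text \<open>If \<open>d\<close> divides \<open>c * k\<close>, it divides \<open>b ^ n * k\<close>,
  and cancelling the powers of \<open>b\<close> gives that \<open>d\<close> divides
  \<open>k\<close>.\<close>

lemma is_lcm_coprime_mult:
  fixes b c d :: "'a::comm_semiring_1"
  assumes c: "c dvd b ^ n" and d: "\<And>k. d dvd b * k \<Longrightarrow> d dvd k"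
  shows "is_lcm (c * d) c d"
  unfolding is_lcm_def
proof (intro conjI allI impI)
  fix e assume e: "c dvd e \<and> d dvd e"
  then obtain k where k: "e = c * k" by (auto simp: dvd_def)
  have "e dvd b ^ n * k" unfolding k using c by (rule mult_dvd_mono) simp
  then have "d dvd b ^ n * k" using e dvd_trans by blast
  then have "d dvd k" using d coprime_power_dvdD by blast
  then show "c * d dvd e" by (simp add: k mult_dvd_mono)
qed simp_all

lemma k_strongly_irreducible_iff_lcm:
  fixes I :: "'a::{subtractive_semiring, unique_factorisation_semidomain} set"
  assumes I: "semiring_ideal I"
  shows "k_strongly_irreducible I \<longleftrightarrow>
    (\<forall>x y m. is_lcm m x y \<and> m \<in> I \<longrightarrow> x \<in> I \<or> y \<in> I)"
proof
  assume irr: "k_strongly_irreducible I"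
  show "\<forall>x y m. is_lcm m x y \<and> m \<in> I \<longrightarrow> x \<in> I \<or> y \<in> I"
  proof (intro allI impI)
    fix x y m assume m: "is_lcm m x y \<and> m \<in> I"
    \<comment> \<open>The intersection consists of the common multiples of \<open>x\<close> and
      \<open>y\<close>, all of them multiples of \<open>m\<close>.\<close>
    have "principal_ideal x \<inter> principal_ideal y \<subseteq> I"
      using m semiring_ideal_dvd[OF I] by (auto simp: is_lcm_def mem_principal_ideal_iff)
    moreover have "k_ideal (principal_ideal z)" for z :: 'a
      by (intro ideal_imp_k_ideal semiring_ideal_principal_ideal)
    ultimately have "principal_ideal x \<subseteq> I \<or> principal_ideal y \<subseteq> I"
      using irr unfolding k_strongly_irreducible_def by blast
    then show "x \<in> I \<or> y \<in> I"
      by (meson dvd_refl mem_principal_ideal_iff subsetD)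
  qed
next
  assume lcm: "\<forall>x y m. is_lcm m x y \<and> m \<in> I \<longrightarrow> x \<in> I \<or> y \<in> I"
  have "A \<subseteq> I \<or> B \<subseteq> I" if A: "k_ideal A" and B: "k_ideal B" and sub: "A \<inter> B \<subseteq> I" for A B
  proof (rule ccontr)
    assume "\<not> ?thesis"
    then obtain a b where ab: "a \<in> A" "a \<notin> I" "b \<in> B" "b \<notin> I" by blast
    then have "a \<noteq> 0" using zero_in_semiring_ideal[OF I] by blast
    then obtain m where m: "is_lcm m a b" using is_lcm_exists by blast
    then have "m \<in> A \<inter> B"
      using A B ab semiring_ideal_dvd unfolding k_ideal_def is_lcm_def by blast
    then show False using lcm m sub ab by blast
  qed
  then show "k_strongly_irreducible I"
    using I ideal_imp_k_ideal unfolding k_strongly_irreducible_def by blast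
qed

lemma lcm_imp_k_primary:
  fixes I :: "'a::{subtractive_semiring, unique_factorisation_semidomain} set"
  assumes I: "semiring_ideal I"
    and lcm: "\<And>x y m. is_lcm m x y \<Longrightarrow> m \<in> I \<Longrightarrow> x \<in> I \<or> y \<in> I"
  shows "k_primary I"
proof -
  have "\<exists>n\<ge>1. b ^ n \<in> I" if ab: "a * b \<in> I" "a \<notin> I" for a b
  proof -
    have "a \<noteq> 0" using ab zero_in_semiring_ideal[OF I] by blast
    then obtain c d n where a: "a = c * d" and c: "c dvd b ^ n"
      and d: "\<And>k. d dvd b * k \<Longrightarrow> d dvd k"
      using coprime_part_exists by metis
    \<comment> \<open>Attaching \<open>b\<close> to \<open>c\<close> makes the product with
      \<open>d\<close> equal to \<open>a * b\<close>, and makes the exponent \<open>Suc n\<close> at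
      least 1 even when \<open>n\<close> is 0.\<close>
    have bc: "b * c dvd b ^ Suc n" using c by (simp add: mult_dvd_mono)
    then have "is_lcm (b * c * d) (b * c) d" using d is_lcm_coprime_mult by blast
    moreover have "b * c * d \<in> I" using ab(1) by (simp add: a ac_simps)
    moreover have "d \<notin> I" using ab(2) semiring_ideal_dvd[OF I] a dvd_triv_right by blast
    ultimately have "b * c \<in> I" using lcm by blast
    then have "b ^ Suc n \<in> I" using semiring_ideal_dvd[OF I] bc by blast
    then show ?thesis by (metis One_nat_def Suc_le_mono le0)
  qed
  then show ?thesis
    using I ideal_imp_k_ideal unfolding k_primary_def by blast
qed

theorem theorem6p5:
  fixes I :: "'a::{subtractive_semiring, unique_factorisation_semidomain} set"
  assumes "semiring_ideal I" and "I \<noteq> UNIV"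
  shows "(k_strongly_irreducible I \<longleftrightarrow>
           (\<forall>x y m. is_lcm m x y \<and> m \<in> I \<longrightarrow> x \<in> I \<or> y \<in> I)) \<and>
         (k_strongly_irreducible I \<longrightarrow> k_primary I)"
  using k_strongly_irreducible_iff_lcm[OF assms(1)] lcm_imp_k_primary[OF assms(1)] by blast

end
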